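(* Let $G$ be a unicyclic graph with girth $3$ and let $Q=\{v\in V(G):\deg(v)=1\}$ with $|Q|=q$. Then \[ Z_{(1)}(G)=\begin{cases} q & \text{if there are at least two cycle vertices of degree at least } 4 \text{ or all cycle vertices have degree at least } 3,\\ q+2 & \text{if there is at most one cycle vertex of degree } 3 \text{ and at least two cycle vertices of degree } 2,\\ q+1 & \text{otherwise.} \end{cases} \] Here degrees are degrees in $G$.
   Context: All graphs are finite, simple and undirected. Let $G$ be a graph, $S\subseteq V(G)$ a set of initially blue vertices (all other vertices white), and $L\subseteq V(G)$ a set of leaks. The leaky color change rule: a blue vertex $b\notin L$ which has exactly one white neighbor $w$ may force $w$ to become blue. $S$ is an $\ell$-leaky forcing set if for every choice of a set $L$ of $\ell$ leaks (chosen after $S$), repeated application of the rule eventually turns all vertices blue. $Z_{(\ell)}(G)$ is the minimum size of an $\ell$-leaky forcing set of $G$; in particular $Z_{(1)}(G)$ is the case $\ell=1$. A unicyclic graph is a connected graph containing exactly one cycle; its girth is the length of that cycle. The vertices of the cycle are called cycle vertices.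
   Formalization: The case q+2 additionally requires that all cycle vertices have degree at most 3; cycle degrees 2, 2 and at least 4 fall under q+1, since q+2 is false there (triangle with two pendant vertices at one vertex: q=2, but the value is at most 3). *)

theory Defs
  imports "Graph_Theory.Graph_Theory"
begin

text \<open>
  Finite simple undirected graphs are the finite, symmetric, loop-free digraphs of locale
  \<open>pair_graph\<close>: every edge \<open>uv\<close> is represented by the two arcs \<open>(u, v)\<close> and \<open>(v, u)\<close>.
  Hence the number of arcs leaving a vertex is its undirected degree.
\<close>

abbreviation degree :: "'a pair_pre_digraph \<Rightarrow> 'a \<Rightarrow> nat" where
  "degree G v \<equiv> out_degree (with_proj G) v"

text \<open>
  An undirected cycle is a subgraph. The library's \<open>cycle\<close> is a closed arc walk without repeated
  vertices, so \<open>[(u, v), (v, u)]\<close> counts as one (excluded here by the length bound), and an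
  undirected cycle is traversed by many such walks, one for each starting vertex and direction
  (identified here by passing to the subgraph traversed).
\<close>

definition cycles :: "'a pair_pre_digraph \<Rightarrow> 'a pair_pre_digraph set" where
  "cycles G = {\<lparr>pverts = fst ` set p, parcs = set p \<union> (set p)\<inverse>\<rparr> | p.
     pre_digraph.cycle (with_proj G) p \<and> 3 \<le> length p}"

definition unicyclic :: "'a pair_pre_digraph \<Rightarrow> bool" where
  "unicyclic G \<longleftrightarrow> pair_graph G \<and> connected (with_proj G) \<and> (\<exists>!C. C \<in> cycles G)"

text \<open>The next two definitions are meaningful for unicyclic graphs only.\<close>

definition cycle_vertices :: "'a pair_pre_digraph \<Rightarrow> 'a set" where
  "cycle_vertices G = pverts (THE C. C \<in> cycles G)"

text \<open>The length of a cycle equals its number of vertices.\<close>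

definition girth :: "'a pair_pre_digraph \<Rightarrow> nat" where
  "girth G = card (cycle_vertices G)"

text \<open>
  \<open>leaky_force G L B B'\<close>: a single application of the leaky color change rule with leaks \<open>L\<close>
  turns the set \<open>B\<close> of blue vertices into \<open>B'\<close>.
\<close>

definition leaky_force :: "'a pair_pre_digraph \<Rightarrow> 'a set \<Rightarrow> 'a set \<Rightarrow> 'a set \<Rightarrow> bool" where
  "leaky_force G L B B' \<longleftrightarrow>
     (\<exists>b w. b \<in> B \<and> b \<notin> L \<and> {x. (b, x) \<in> parcs G \<and> x \<notin> B} = {w} \<and> B' = insert w B)"

definition leaky_forcing_set :: "'a pair_pre_digraph \<Rightarrow> nat \<Rightarrow> 'a set \<Rightarrow> bool" where
  "leaky_forcing_set G l S \<longleftrightarrow> S \<subseteq> pverts G \<and>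
     (\<forall>L. L \<subseteq> pverts G \<and> card L = l \<longrightarrow> (leaky_force G L)\<^sup>*\<^sup>* S (pverts G))"

definition leaky_forcing_number :: "nat \<Rightarrow> 'a pair_pre_digraph \<Rightarrow> nat" where
  "leaky_forcing_number l G = Min (card ` {S. leaky_forcing_set G l S})"

text \<open>
  Convention for the case \<open>q + 2\<close> of the formula for unicyclic graphs of girth 3: ``at most one
  cycle vertex of degree 3 and at least two cycle vertices of degree 2'' is understood as
  describing all three cycle vertices, i.e. every cycle vertex has degree 2 or 3 (stated as the
  bound \<open>degree G v \<le> 3\<close>, since cycle vertices have degree at least 2). Degrees 2, 2 and at
  least 4 thus belong to the case \<open>q + 1\<close>. The bound is needed: for a triangle \<open>abc\<close> with two
  pendant vertices \<open>x\<close>, \<open>y\<close> attached to \<open>c\<close> one has \<open>q = 2\<close>, no cycle vertex of degree 3 and two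
  of degree 2, but \<open>{x, y, a}\<close> is a 1-leaky forcing set of size \<open>q + 1\<close>.
\<close>

end

theory Submission
  imports Defs
begin

text \<open>
  Call two cycle vertices a thin pair if one of them has degree 2 and the other degree at most 3.
  The theorem follows from a description of all 1-leaky forcing sets (\<open>leaky_forcing_set_iff\<close>):
  a set of vertices is 1-leaky forcing iff it contains all leaves and meets every thin pair.
  Leaves are not on the cycle, so the forcing number is \<open>q\<close> plus the least number of cycle
  vertices that meet every thin pair. With only three cycle vertices, the degrees tell which pairs
  are thin: none of them (\<open>q\<close>), all three, where two vertices are needed (\<open>q + 2\<close>), or at least
  one, with all thin pairs sharing a vertex (\<open>q + 1\<close>).

  For a given leak, a set fails to turn everything blue iff it is contained in a proper subset \<open>B\<close>
  of the vertices that is stalled: with \<open>B\<close> as the blue set, no blue vertex other than the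
  leak has exactly one white neighbor.

  Necessity: a missing leaf stays white when its neighbor leaks. A thin pair \<open>u\<close>, \<open>v\<close> that is
  missed stays white as well: the third cycle vertex sees both of them, and the only other neighbor
  of the pair, if any, is made the leak.

  Sufficiency is a count of edges. Suppose that \<open>B\<close> contains all leaves and is stalled with
  leak \<open>l\<close>. Take the subgraph \<open>F\<close> of all edges with a white end. In \<open>F\<close> the white vertices
  keep their degree, which is at least 2, and every blue vertex of \<open>F\<close> except possibly \<open>l\<close>
  has degree at least 2. Hence the degree sum of \<open>F\<close> is at least twice its number of vertices,
  minus 1. The degree sum of a forest is smaller than that (\<open>forest_card_arcs\<close>), so \<open>F\<close> contains the triangle.
  Each edge of the triangle therefore has a white end, so two cycle vertices are white. On
  the other hand, the degree sum of any subgraph of \<open>G\<close> is at most twice its number of vertices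
  (\<open>card_arcs_le\<close>). So the degrees of these two white vertices exceed 2 by at most 1 in
  total: the two form a thin pair that \<open>B\<close> misses.
\<close>

section \<open>Stalled sets\<close>

definition stalled :: "'a pair_pre_digraph \<Rightarrow> 'a set \<Rightarrow> 'a set \<Rightarrow> bool" where
  "stalled G L B \<longleftrightarrow> (\<forall>b \<in> B - L. card (parcs G `` {b} - B) \<noteq> 1)"

lemma stalled_iff_no_force: "stalled G L B \<longleftrightarrow> \<not> (\<exists>B'. leaky_force G L B B')"
proof -
  have "{x. (b, x) \<in> parcs G \<and> x \<notin> B} = parcs G `` {b} - B" for b
    by auto
  then show ?thesis
    unfolding stalled_def leaky_force_def One_nat_def card_1_singleton_iff by blast
qed

text \<open>
  Forcing cannot leave a stalled superset of \<open>S\<close>: a force from a smaller blue set onto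
  a vertex outside would also be possible in the stalled set, as its white vertices are fewer.
  Conversely, without proper stalled supersets some force is always available.
\<close>

lemma (in pair_fin_digraph) forces_all_iff_no_stalled:
  assumes "S \<subseteq> pverts G"
  shows "(leaky_force G L)\<^sup>*\<^sup>* S (pverts G) \<longleftrightarrow>
    (\<forall>B. S \<subseteq> B \<and> B \<subset> pverts G \<longrightarrow> \<not> stalled G L B)" (is "?L \<longleftrightarrow> ?R")
proof
  assume forces: ?L
  show ?R
  proof (intro allI impI notI)
    fix B assume B: "S \<subseteq> B \<and> B \<subset> pverts G" and st: "stalled G L B"
    have "A \<subseteq> B" if "(leaky_force G L)\<^sup>*\<^sup>* S A" for A
      using that
    proof induction
      case base
      then show ?case using B by simp
    next
      case (step A A')
      then obtain b w where bw: "b \<in> A" "b \<notin> L" "{x. (b, x) \<in> parcs G \<and> x \<notin> A} = {w}"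
          "A' = insert w A"
        by (auto simp: leaky_force_def)
      have "w \<in> B"
      proof (rule ccontr)
        assume "w \<notin> B"
        then have "{x. (b, x) \<in> parcs G \<and> x \<notin> B} = {w}"
          using bw(3) step.IH by blast
        then have "leaky_force G L B (insert w B)"
          using bw step.IH by (auto simp: leaky_force_def)
        with st show False
          by (auto simp: stalled_iff_no_force)
      qed
      with step.IH bw(4) show ?case by simp
    qed
    with forces B show False by blast
  qed
next
  assume R: ?R
  have "(leaky_force G L)\<^sup>*\<^sup>* B (pverts G)" if "S \<subseteq> B" "B \<subseteq> pverts G" for B
    using that
  proof (induction "card (pverts G - B)" arbitrary: B rule: less_induct)
    case less
    show ?case
    proof (cases "B = pverts G")
      case True
      then show ?thesis by simp
    next
      case False
      then obtain B' where B': "leaky_force G L B B'"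
        using R less.prems unfolding stalled_iff_no_force by (meson psubsetI)
      then obtain b w where w: "(b, w) \<in> parcs G" "w \<notin> B" "B' = insert w B"
        by (auto simp: leaky_force_def)
      have wV: "w \<in> pverts G"
        using w(1) by (rule in_arcsD2)
      have "card (pverts G - B') < card (pverts G - B)"
        using w wV pair_finite_verts by (intro psubset_card_mono) auto
      then have "(leaky_force G L)\<^sup>*\<^sup>* B' (pverts G)"
        using w wV less.prems by (intro less.hyps) auto
      with B' show ?thesis
        by (rule converse_rtranclp_into_rtranclp)
    qed
  qed
  from this[of S] assms show ?L by simp
qed

section \<open>Cycles and degrees in sets of arcs\<close>

text \<open>
  Cycles are taken in a set of arcs rather than in a graph, so that they can be used for subgraphs
  without fixing a vertex set.
\<close>

definition cycle_in :: "'a rel \<Rightarrow> ('a \<times> 'a) list \<Rightarrow> bool" where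
  "cycle_in F p \<longleftrightarrow> 3 \<le> length p \<and> set p \<subseteq> F \<and>
     (\<exists>u. pcas u p u \<and> distinct (tl (pawalk_verts u p)))"

lemma cycle_in_mono: "cycle_in F p \<Longrightarrow> F \<subseteq> F' \<Longrightarrow> cycle_in F' p"
  by (auto simp: cycle_in_def)

lemma cycle_in_parcs_iff:
  assumes "pair_wf_digraph G"
  shows "cycle_in (parcs G) p \<longleftrightarrow> pre_digraph.cycle (with_proj G) p \<and> 3 \<le> length p"
proof -
  interpret pair_wf_digraph G by fact
  have "u \<in> pverts G" if "pcas u p u" "set p \<subseteq> parcs G" "p \<noteq> []" for u
    using that by (cases p) (auto dest: arc_fst_in_verts)
  moreover have "p \<noteq> []" if "3 \<le> length p"
    using that by auto
  ultimately show ?thesis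
    unfolding cycle_in_def cycle_def awalk_def by blast
qed

text \<open>
  The list \<open>zip (u # ys) (ys @ [v])\<close> consists of the arcs of the walk through \<open>u\<close>, \<open>ys\<close>, \<open>v\<close>.
  This lets cycles be constructed from vertex lists.
\<close>

lemma vertex_list_arcs:
  "pcas u (zip (u # ys) (ys @ [v])) v"
  "pawalk_verts u (zip (u # ys) (ys @ [v])) = u # ys @ [v]"
  "set (zip (u # ys) (ys @ [v])) \<subseteq> F \<longleftrightarrow> successively (\<lambda>x y. (x, y) \<in> F) (u # ys @ [v])"
  by (induction ys arbitrary: u) auto

lemma cycle_in_of_vertices:
  assumes "distinct (u # ys)" "2 \<le> length ys"
    "successively (\<lambda>x y. (x, y) \<in> F) (u # ys @ [u])"
  shows "\<exists>p. cycle_in F p"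
proof
  show "cycle_in F (zip (u # ys) (ys @ [u]))"
    unfolding cycle_in_def vertex_list_arcs(3)
  proof (intro conjI exI)
    show "pcas u (zip (u # ys) (ys @ [u])) u"
      by (rule vertex_list_arcs)
  qed (use assms in \<open>auto simp: vertex_list_arcs(2) simp del: zip_Cons_Cons\<close>)
qed

text \<open>
  All neighbors of the first vertex of a longest path lie on the path. Besides the next
  vertex there is a second such neighbor, and it closes a cycle.
\<close>

lemma min_degree_two_imp_cycle:
  assumes "finite F" "sym F" "irrefl F" "F \<noteq> {}"
    and deg: "\<And>v. v \<in> fst ` F \<Longrightarrow> 2 \<le> card (F `` {v})"
  shows "\<exists>p. cycle_in F p"
proof -
  let ?P = "\<lambda>xs. xs \<noteq> [] \<and> distinct xs \<and> successively (\<lambda>x y. (x, y) \<in> F) xs \<and> set xs \<subseteq> fst ` F"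
  obtain u v where "(u, v) \<in> F"
    using assms(4) by auto
  then have "?P [u]"
    by force
  moreover have "length xs < Suc (card (fst ` F))" if "?P xs" for xs
    using that assms(1) card_mono[of "fst ` F" "set xs"]
    by (auto simp: distinct_card less_Suc_eq_le)
  ultimately obtain xs where xs: "?P xs" and max: "\<And>ys. ?P ys \<Longrightarrow> length ys \<le> length xs"
    using ex_has_greatest_nat[of ?P "[u]" length "Suc (card (fst ` F))"] by blast
  obtain x zs where x: "xs = x # zs"
    using xs by (cases xs) auto
  have nbrs: "F `` {x} \<subseteq> set zs"
  proof
    fix y assume "y \<in> F `` {x}"
    then have xy: "(x, y) \<in> F" by simp
    then have yx: "(y, x) \<in> F" "y \<noteq> x"
      using assms by (auto dest: symD simp: irrefl_def)
    show "y \<in> set zs"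
    proof (rule ccontr)
      assume "y \<notin> set zs"
      then have "?P (y # xs)"
        using xs yx unfolding x by force
      from max[OF this] show False by simp
    qed
  qed
  have "2 \<le> card (F `` {x})"
    using xs by (intro deg) (simp add: x)
  then have "\<not> F `` {x} \<subseteq> {hd zs}"
    using card_mono[of "{hd zs}" "F `` {x}"] by auto
  then obtain y where y: "(x, y) \<in> F" "y \<noteq> hd zs"
    by blast
  with nbrs obtain us vs where zs: "zs = us @ y # vs"
    by (metis Image_singleton_iff split_list subsetD)
  with y(2) have "us \<noteq> []"
    by auto
  show ?thesis
  proof (rule cycle_in_of_vertices)
    show "distinct (x # us @ [y])"
      using xs by (auto simp: x zs)
    show "2 \<le> length (us @ [y])"
      using \<open>us \<noteq> []\<close> by (cases us) auto
    show "successively (\<lambda>x y. (x, y) \<in> F) (x # (us @ [y]) @ [x])"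
      using xs y(1) \<open>us \<noteq> []\<close> symD[OF assms(2)]
      by (auto simp: x zs successively_append_iff successively_Cons)
  qed
qed

lemma card_arcs_eq_sum_degrees:
  assumes "finite F"
  shows "card F = (\<Sum>v \<in> fst ` F. card (F `` {v}))"
proof -
  have "F = Sigma (fst ` F) (\<lambda>v. F `` {v})"
    by force
  then have "card F = card (Sigma (fst ` F) (\<lambda>v. F `` {v}))"
    by simp
  also have "\<dots> = (\<Sum>v \<in> fst ` F. card (F `` {v}))"
    using assms by (intro card_SigmaI) (auto intro: finite_Image)
  finally show ?thesis .
qed

text \<open>
  Deleting a leaf of the forest removes one vertex and two arcs. The last edge to be deleted leaves
  no arc, but removes two vertices, and this is where the summand 2 comes from.
\<close>

lemma forest_card_arcs:
  assumes "finite F" "sym F" "irrefl F" "F \<noteq> {}" "\<nexists>p. cycle_in F p"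
  shows "card F + 2 \<le> 2 * card (fst ` F)"
  using assms
proof (induction "card F" arbitrary: F rule: less_induct)
  case less
  obtain v where v: "v \<in> fst ` F" "card (F `` {v}) < 2"
    using min_degree_two_imp_cycle[of F] less.prems by (meson not_le)
  have "F `` {v} \<noteq> {}" "finite (F `` {v})"
    using v(1) less.prems(1) by (auto intro: finite_Image)
  with v(2) have "card (F `` {v}) = 1"
    by (metis One_nat_def card_gt_0_iff less_2_cases less_irrefl)
  then obtain w where w: "F `` {v} = {w}"
    by (auto simp: card_1_singleton_iff)
  then have vw: "(v, w) \<in> F" "(w, v) \<in> F" "v \<noteq> w"
    using less.prems by (auto dest: symD simp: irrefl_def)
  define F' where "F' = F - {(v, w), (w, v)}"
  have F: "F = insert (v, w) (insert (w, v) F')" and fin: "finite F'"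
    using vw less.prems(1) by (auto simp: F'_def)
  have card: "card F = card F' + 2"
    unfolding F using fin vw(3) by (auto simp: F'_def)
  have verts: "fst ` F' \<subseteq> fst ` F - {v}"
  proof
    fix x assume "x \<in> fst ` F'"
    then obtain y where y: "(x, y) \<in> F'" by auto
    then have "x \<noteq> v"
      using w by (auto simp: F'_def)
    with y show "x \<in> fst ` F - {v}"
      by (force simp: F'_def)
  qed
  have "card (fst ` F') \<le> card (fst ` F - {v})"
    using verts less.prems(1) by (intro card_mono) auto
  also have "\<dots> < card (fst ` F)"
    using less.prems(1) v(1) by (intro card_Diff1_less) auto
  finally have verts_card: "card (fst ` F') < card (fst ` F)" .
  show ?case
  proof (cases "F' = {}")
    case True
    then show ?thesis
      using vw(3) by (simp add: F)
  next
    case False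
    have "card F' + 2 \<le> 2 * card (fst ` F')"
    proof (rule less.hyps)
      show "sym F'"
        using less.prems(2) by (auto simp: F'_def sym_def)
      show "irrefl F'"
        using less.prems(3) by (auto simp: F'_def irrefl_def)
      show "\<nexists>p. cycle_in F' p"
        using less.prems(5) cycle_in_mono[of F' _ F] by (auto simp: F)
    qed (use fin False card in auto)
    with verts_card card show ?thesis by simp
  qed
qed

lemma degree_eq_card_Image: "degree G v = card (parcs G `` {v})"
proof -
  have "out_arcs (with_proj G) v = Pair v ` (parcs G `` {v})"
    by (auto simp: out_arcs_def)
  then show ?thesis
    by (simp add: out_degree_def card_image inj_on_def)
qed

section \<open>Unicyclic graphs whose cycle is a triangle\<close>

text \<open>
  Uniqueness of the cycle enters the count of edges in the form that every cycle runs through the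
  three edges of the triangle, and connectedness in the form that no vertex is isolated.
\<close>

locale unicyclic_triangle = pair_graph G for G :: "'a pair_pre_digraph" +
  fixes a b c :: 'a
  assumes distinct_abc: "a \<noteq> b" "b \<noteq> c" "c \<noteq> a"
    and triangle: "(a, b) \<in> parcs G" "(b, c) \<in> parcs G" "(c, a) \<in> parcs G"
    and unique_cycle: "cycle_in (parcs G) p \<Longrightarrow> {(a, b), (b, c), (c, a)} \<subseteq> set p \<union> (set p)\<inverse>"
    and no_isolated: "v \<in> pverts G \<Longrightarrow> parcs G `` {v} \<noteq> {}"

lemma unicyclic_girth_3_triangle:
  assumes "unicyclic G" "girth G = 3"
  obtains a b c where "unicyclic_triangle G a b c" "cycle_vertices G = {a, b, c}"
proof -
  have pg: "pair_graph G" and conn: "connected (with_proj G)" and ex1: "\<exists>!C. C \<in> cycles G"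
    using assms(1) by (auto simp: unicyclic_def)
  interpret pair_graph G by fact
  have wf_G: "pair_wf_digraph G" by unfold_locales
  define C where "C = (THE C. C \<in> cycles G)"
  have C: "C \<in> cycles G"
    unfolding C_def by (rule theI'[OF ex1])
  have C_unique: "C' = C" if "C' \<in> cycles G" for C'
    using the1_equality[OF ex1 that] by (simp add: C_def)
  from C obtain p where p: "cycle p" "3 \<le> length p"
      and C_eq: "C = \<lparr>pverts = fst ` set p, parcs = set p \<union> (set p)\<inverse>\<rparr>"
    by (auto simp: cycles_def)
  have verts_eq: "cycle_vertices G = fst ` set p"
    using C_eq by (simp add: cycle_vertices_def C_def)
  obtain u where u: "pcas u p u" "distinct (tl (pawalk_verts u p))" "set p \<subseteq> parcs G"
    using p(1) by (auto simp: cycle_def awalk_def)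
  have "p \<noteq> []" using p(2) by auto
  \<comment> \<open>The vertices along the closed walk, listed with the repeated end point at either end, show that
     tails and heads of the arcs are the same up to order; so there are as many arcs as vertices.\<close>
  have "map fst p @ [snd (last p)] = u # map snd p"
    using awalk_verts_conv[of u p] awalk_verts_conv'[of u p u] u(1) \<open>p \<noteq> []\<close>
    by (cases p) auto
  moreover have "snd (last p) = u"
    using u(1) \<open>p \<noteq> []\<close> calculation
    by (metis awalk_verts_conv awlast_if_cas last_snoc)
  ultimately have "mset (map fst p) = mset (map snd p)"
    by (metis add_mset_add_mset_same_iff mset.simps(2) mset_append union_mset_add_mset_right
        add.right_neutral mset.simps(1))
  moreover have "distinct (map snd p)"
    using u(2) awalk_verts_conv'[of u p u] u(1) \<open>p \<noteq> []\<close> by simp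
  ultimately have dist: "distinct (map fst p)"
    using mset_eq_imp_distinct_iff by blast
  then have "length p = 3"
    using assms(2) distinct_card[OF dist] by (simp add: girth_def verts_eq)
  then obtain e1 e2 e3 where p_eq: "p = [e1, e2, e3]"
    by (auto simp: length_Suc_conv numeral_3_eq_3)
  obtain a b c where e: "e1 = (a, b)" "e2 = (b, c)" "e3 = (c, a)"
    using u(1) by (cases e1; cases e2; cases e3) (auto simp: p_eq)
  have "unicyclic_triangle G a b c"
  proof unfold_locales
    show "a \<noteq> b" "b \<noteq> c" "c \<noteq> a"
      using dist by (auto simp: p_eq e)
    show "(a, b) \<in> parcs G" "(b, c) \<in> parcs G" "(c, a) \<in> parcs G"
      using u(3) by (auto simp: p_eq e)
  next
    fix p' assume "cycle_in (parcs G) p'"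
    then have "cycle p'" "3 \<le> length p'"
      by (simp_all add: cycle_in_parcs_iff[OF wf_G])
    then have "\<lparr>pverts = fst ` set p', parcs = set p' \<union> (set p')\<inverse>\<rparr> = C"
      by (intro C_unique) (auto simp: cycles_def)
    then have "set p' \<union> (set p')\<inverse> = set p \<union> (set p)\<inverse>"
      by (simp add: C_eq)
    then show "{(a, b), (b, c), (c, a)} \<subseteq> set p' \<union> (set p')\<inverse>"
      by (simp add: p_eq e)
  next
    fix v assume v: "v \<in> pverts G"
    have ab: "a \<in> pverts G" "b \<in> pverts G" "a \<noteq> b"
      using u(3) dist by (auto simp: p_eq e dest: in_arcsD1 in_arcsD2)
    then obtain t where t: "t \<in> pverts G" "t \<noteq> v" by metis
    have "strongly_connected (with_proj (mk_symmetric (with_proj G)))"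
      using conn by (simp add: connected_def)
    then have "v \<rightarrow>\<^sup>*\<^bsub>with_proj (mk_symmetric (with_proj G))\<^esub> t"
      using v t by (auto simp: strongly_connected_def)
    then have "v \<rightarrow>\<^sup>*\<^bsub>with_proj G\<^esub> t"
      using reachable_mk_symmetric_eq pair_sym_arcs by blast
    then show "parcs G `` {v} \<noteq> {}"
      using t(2) by (cases rule: converse_reachable_cases) auto
  qed
  moreover have "cycle_vertices G = {a, b, c}"
    by (auto simp: verts_eq p_eq e)
  ultimately show thesis by (rule that)
qed

context unicyclic_triangle
begin

lemma sym_parcs: "sym (parcs G)"
  using pair_sym_arcs by (simp add: symmetric_def)

lemma irrefl_parcs: "irrefl (parcs G)"
  using pair_no_loops by (force simp: irrefl_def)

lemma triangle_adjacent:
  assumes "u \<in> {a, b, c}" "v \<in> {a, b, c}" "u \<noteq> v"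
  shows "(u, v) \<in> parcs G"
  using assms triangle symD[OF sym_parcs] by auto

lemma triangle_in_verts: "{a, b, c} \<subseteq> pverts G"
  using triangle by (auto dest: in_arcsD1)

lemma finite_nbrs: "finite (parcs G `` {v})"
  using pair_finite_arcs by (rule finite_Image)

lemma degree_triangle_ge_2:
  assumes "u \<in> {a, b, c}"
  shows "2 \<le> degree G u"
proof -
  have "{a, b, c} - {u} \<subseteq> parcs G `` {u}"
    using assms triangle_adjacent by auto
  then have "card ({a, b, c} - {u}) \<le> degree G u"
    unfolding degree_eq_card_Image using finite_nbrs by (rule card_mono[rotated])
  moreover have "card ({a, b, c} - {u}) = 2"
    using assms distinct_abc by auto
  ultimately show ?thesis by simp
qed

text \<open>A subgraph that lacks an edge of the triangle has no cycle and is thus a forest.\<close>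

lemma card_arcs_without_triangle:
  assumes "F \<subseteq> parcs G" "sym F" "F \<noteq> {}" "\<not> {(a, b), (b, c), (c, a)} \<subseteq> F"
  shows "card F + 2 \<le> 2 * card (fst ` F)"
proof (rule forest_card_arcs)
  show "finite F"
    using assms(1) pair_finite_arcs by (rule finite_subset)
  show "irrefl F"
    using assms(1) irrefl_parcs by (auto simp: irrefl_def)
  show "\<nexists>p. cycle_in F p"
  proof
    assume "\<exists>p. cycle_in F p"
    then obtain p where p: "cycle_in F p" ..
    then have "{(a, b), (b, c), (c, a)} \<subseteq> set p \<union> (set p)\<inverse>"
      using assms(1) by (intro unique_cycle) (rule cycle_in_mono)
    moreover have "set p \<union> (set p)\<inverse> \<subseteq> F"
      using p assms(2) by (auto simp: cycle_in_def dest: symD)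
    ultimately show False
      using assms(4) by blast
  qed
qed (use assms in auto)

text \<open>If the subgraph contains the triangle, deleting one edge of the triangle makes it a forest.\<close>

lemma card_arcs_le:
  assumes "F \<subseteq> parcs G" "sym F"
  shows "card F \<le> 2 * card (fst ` F)"
proof (cases "{(a, b), (b, c), (c, a)} \<subseteq> F")
  case False
  then show ?thesis
    using card_arcs_without_triangle[OF assms] by (cases "F = {}") auto
next
  case True
  have fin: "finite F"
    using assms(1) pair_finite_arcs by (rule finite_subset)
  define F' where "F' = F - {(a, b), (b, a)}"
  have F: "F = insert (a, b) (insert (b, a) F')"
    using True symD[OF assms(2)] by (auto simp: F'_def)
  have "card F = card F' + 2"
    unfolding F using fin distinct_abc by (auto simp: F'_def)
  moreover have "card F' + 2 \<le> 2 * card (fst ` F')"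
  proof (rule card_arcs_without_triangle)
    show "sym F'"
      using assms(2) by (auto simp: F'_def sym_def)
    have "(b, c) \<in> F'"
      using True distinct_abc by (auto simp: F'_def)
    then show "F' \<noteq> {}" by auto
  qed (use assms in \<open>auto simp: F'_def\<close>)
  moreover have "card (fst ` F') \<le> card (fst ` F)"
    using fin by (intro card_mono) (auto simp: F'_def)
  ultimately show ?thesis by simp
qed

text \<open>
  Cycle vertices have degree at least 2, so the bound on the sum says that one degree is 2
  and the other at most 3. The sum is what the count of edges produces.
\<close>

definition thin_pair :: "'a \<Rightarrow> 'a \<Rightarrow> bool" where
  "thin_pair u v \<longleftrightarrow> u \<in> {a, b, c} \<and> v \<in> {a, b, c} \<and> u \<noteq> v \<and> degree G u + degree G v \<le> 5"

text \<open>
  Degree sum in the subgraph \<open>F\<close> of all edges with a white end: every vertex contributes at least 2,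
  except for a deficit of at most 1 at the leak, and every white vertex contributes its excess over 2.
  The upper bounds on the number of arcs leave room for a total excess of at most 1.
\<close>

lemma stalled_imp_white_thin_pair:
  assumes B: "B \<subset> pverts G" and leaves: "{v \<in> pverts G. degree G v = 1} \<subseteq> B"
    and stalled: "stalled G {l} B"
  shows "\<exists>u v. thin_pair u v \<and> u \<notin> B \<and> v \<notin> B"
proof -
  define W where "W = pverts G - B"
  define F where "F = {(x, y) \<in> parcs G. x \<in> W \<or> y \<in> W}"
  define T where "T = fst ` F"
  have F_sub: "F \<subseteq> parcs G" and sym: "sym F"
    using symD[OF sym_parcs] by (auto simp: F_def sym_def)
  have fin: "finite F" "finite T"
    using finite_subset[OF F_sub pair_finite_arcs] by (simp_all add: T_def)
  have F_white: "F `` {v} = parcs G `` {v}" if "v \<in> W" for v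
    using that by (auto simp: F_def)
  have F_blue: "F `` {v} = parcs G `` {v} - B" if "v \<notin> W" for v
    using that by (auto simp: F_def W_def dest: in_arcsD2)
  have deg_white: "2 \<le> degree G v" if "v \<in> W" for v
  proof -
    have "degree G v \<noteq> 0"
      using no_isolated[of v] that finite_nbrs by (simp add: W_def degree_eq_card_Image)
    moreover have "degree G v \<noteq> 1"
      using that leaves by (auto simp: W_def)
    ultimately show ?thesis by linarith
  qed
  have W_T: "W \<subseteq> T"
  proof
    fix v assume v: "v \<in> W"
    then obtain y where "(v, y) \<in> parcs G"
      using no_isolated[of v] by (auto simp: W_def)
    with v show "v \<in> T"
      by (force simp: T_def F_def)
  qed
  have excess: "2 + (if v \<in> W then degree G v - 2 else 0)
      \<le> card (F `` {v}) + (if v = l then 1 else 0)" if "v \<in> T" for v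
  proof (cases "v \<in> W")
    case True
    then show ?thesis
      using deg_white[OF True] by (simp add: F_white degree_eq_card_Image)
  next
    case False
    have "F `` {v} \<noteq> {}" "finite (F `` {v})" "v \<in> B"
      using that False F_sub fin(1)
      by (auto simp: T_def W_def intro: finite_Image dest: in_arcsD1)
    moreover from this have "v \<noteq> l \<Longrightarrow> card (F `` {v}) \<noteq> 1"
      using stalled False by (auto simp: stalled_def F_blue)
    ultimately show ?thesis
      using False card_gt_0_iff[of "F `` {v}"] by (auto simp del: card_gt_0_iff)
  qed
  have "(\<Sum>v\<in>T. 2 + (if v \<in> W then degree G v - 2 else 0))
      \<le> (\<Sum>v\<in>T. card (F `` {v}) + (if v = l then 1 else 0))"
    by (intro sum_mono excess)
  also have "\<dots> \<le> card F + 1"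
    using fin card_arcs_eq_sum_degrees[OF fin(1)] by (simp add: sum.distrib T_def)
  also have "(\<Sum>v\<in>T. 2 + (if v \<in> W then degree G v - 2 else 0))
      = 2 * card T + (\<Sum>v\<in>W. degree G v - 2)"
    using sum.inter_restrict[OF fin(2), of "\<lambda>v. degree G v - 2" W] W_T
    by (simp add: sum.distrib Int_absorb1 del: add_2_eq_Suc add_2_eq_Suc')
  finally have count: "2 * card T + (\<Sum>v\<in>W. degree G v - 2) \<le> card F + 1" .
  have "F \<noteq> {}"
    using W_T B by (auto simp: W_def T_def)
  then have tri: "{(a, b), (b, c), (c, a)} \<subseteq> F"
    using card_arcs_without_triangle[OF F_sub sym] count by (force simp: T_def)
  then obtain u v where uv: "u \<in> {a, b, c}" "v \<in> {a, b, c}" "u \<noteq> v" "u \<in> W" "v \<in> W"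
    using distinct_abc by (auto simp: F_def)
  have "(\<Sum>v\<in>{u, v}. degree G v - 2) \<le> (\<Sum>v\<in>W. degree G v - 2)"
    using uv W_T fin(2) by (intro sum_mono2) (auto intro: finite_subset)
  with count card_arcs_le[OF F_sub sym] have "(degree G u - 2) + (degree G v - 2) \<le> 1"
    using uv(3) by (simp add: T_def)
  then have "thin_pair u v"
    using uv by (simp add: thin_pair_def)
  with uv show ?thesis
    by (auto simp: W_def)
qed

text \<open>
  The form in which stalled sets are used for lower bounds: \<open>W\<close> is a set of white vertices that
  can never be entered when \<open>l\<close> leaks.
\<close>

lemma leaky_forcing_set_meets_stalled_white:
  assumes S: "leaky_forcing_set G 1 S" and l: "l \<in> pverts G" and W: "W \<subseteq> pverts G" "W \<noteq> {}"
    and stalled: "\<And>x. x \<in> pverts G \<Longrightarrow> x \<notin> W \<Longrightarrow> x \<noteq> l \<Longrightarrow> card (parcs G `` {x} \<inter> W) \<noteq> 1"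
  shows "S \<inter> W \<noteq> {}"
proof
  assume "S \<inter> W = {}"
  have "S \<subseteq> pverts G" "(leaky_force G {l})\<^sup>*\<^sup>* S (pverts G)"
    using S l by (auto simp: leaky_forcing_set_def)
  moreover have "S \<subseteq> pverts G - W" "pverts G - W \<subset> pverts G"
    using \<open>S \<inter> W = {}\<close> \<open>S \<subseteq> pverts G\<close> W by auto
  ultimately have "\<not> stalled G {l} (pverts G - W)"
    using forces_all_iff_no_stalled by blast
  moreover have "parcs G `` {x} - (pverts G - W) = parcs G `` {x} \<inter> W" for x
    using W(1) by (auto dest: in_arcsD2)
  then have "stalled G {l} (pverts G - W)"
    using stalled by (auto simp: stalled_def)
  ultimately show False by contradiction
qed

lemma leaky_forcing_set_contains_leaves:
  assumes S: "leaky_forcing_set G 1 S" and v: "v \<in> pverts G" "degree G v = 1"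
  shows "v \<in> S"
proof -
  obtain y where y: "parcs G `` {v} = {y}"
    using v(2) by (auto simp: degree_eq_card_Image card_1_singleton_iff)
  have "S \<inter> {v} \<noteq> {}"
  proof (rule leaky_forcing_set_meets_stalled_white[OF S, of y])
    show "y \<in> pverts G"
      using y in_arcsD2[of v y] by auto
    fix x assume "x \<noteq> y"
    then have "parcs G `` {x} \<inter> {v} = {}"
      using y symD[OF sym_parcs] by blast
    then show "card (parcs G `` {x} \<inter> {v}) \<noteq> 1"
      by simp
  qed (use v in auto)
  then show ?thesis by simp
qed

text \<open>
  Let \<open>u\<close> have degree 2 and let \<open>t\<close> be the third cycle vertex. If both \<open>u\<close> and \<open>v\<close> are white,
  only \<open>t\<close> and the possible third neighbor \<open>y\<close> of \<open>v\<close> could force one of them. But \<open>t\<close> has two white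
  neighbors, and \<open>y\<close> is chosen as the leak.
\<close>

lemma leaky_forcing_set_hits_thin_pair:
  assumes S: "leaky_forcing_set G 1 S" and uv: "thin_pair u v"
  shows "u \<in> S \<or> v \<in> S"
  using uv
proof (induction "degree G u" "degree G v" arbitrary: u v rule: linorder_wlog)
  case sym
  then show ?case by (auto simp: thin_pair_def)
next
  case le
  from le.prems have uv: "u \<in> {a, b, c}" "v \<in> {a, b, c}" "u \<noteq> v"
      and deg: "degree G u + degree G v \<le> 5"
    by (auto simp: thin_pair_def)
  then have deg_u: "degree G u = 2" and deg_v: "degree G v \<le> 3"
    using le.hyps degree_triangle_ge_2[of u] degree_triangle_ge_2[of v] by linarith+
  obtain t where t: "t \<in> {a, b, c}" "t \<noteq> u" "t \<noteq> v"
    using distinct_abc by (metis insertCI)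
  have u_nbrs: "parcs G `` {u} = {v, t}"
  proof (rule sym, rule card_subset_eq[OF finite_nbrs])
    show "{v, t} \<subseteq> parcs G `` {u}"
      using uv t triangle_adjacent by auto
    show "card {v, t} = card (parcs G `` {u})"
      using deg_u t by (simp add: degree_eq_card_Image)
  qed
  have "{u, t} \<subseteq> parcs G `` {v}"
    using uv t triangle_adjacent by auto
  then have "card (parcs G `` {v} - {u, t}) \<le> 1"
    using deg_v t by (simp add: card_Diff_subset degree_eq_card_Image)
  then have third: "\<exists>y. parcs G `` {v} - {u, t} \<subseteq> {y}"
    using finite_nbrs[of v] by (metis card_1_singletonE card_eq_0_iff empty_subsetI finite_Diff
        le_eq_less_or_eq less_one order_refl)
  have "\<exists>y \<in> pverts G. parcs G `` {v} \<subseteq> {u, t, y}"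
  proof (cases "parcs G `` {v} - {u, t} = {}")
    case True
    \<comment> \<open>Here any vertex can be the leak.\<close>
    then have "parcs G `` {v} \<subseteq> {u, t, t}" by blast
    moreover have "t \<in> pverts G"
      using t(1) triangle_in_verts by (rule subsetD[rotated])
    ultimately show ?thesis by (rule rev_bexI[rotated])
  next
    case False
    then obtain y where y: "y \<in> parcs G `` {v} - {u, t}" by blast
    with third have "parcs G `` {v} \<subseteq> {u, t, y}" by blast
    moreover have "y \<in> pverts G"
      using y in_arcsD2[of v y] by simp
    ultimately show ?thesis by (rule rev_bexI[rotated])
  qed
  then obtain y where v_nbrs: "parcs G `` {v} \<subseteq> {u, t, y}" "y \<in> pverts G"
    by (elim bexE)
  have "S \<inter> {u, v} \<noteq> {}"
  proof (rule leaky_forcing_set_meets_stalled_white[OF S v_nbrs(2)])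
    show "{u, v} \<subseteq> pverts G"
      using uv triangle_in_verts by auto
    fix x assume x: "x \<notin> {u, v}" "x \<noteq> y"
    show "card (parcs G `` {x} \<inter> {u, v}) \<noteq> 1"
    proof (cases "x = t")
      case True
      then have "parcs G `` {x} \<inter> {u, v} = {u, v}"
        using uv t triangle_adjacent by auto
      then show ?thesis
        using uv(3) by simp
    next
      case False
      then have "parcs G `` {x} \<inter> {u, v} = {}"
        using x u_nbrs v_nbrs(1) symD[OF sym_parcs] by blast
      then show ?thesis by simp
    qed
  qed simp
  then show ?case by auto
qed

proposition leaky_forcing_set_iff:
  "leaky_forcing_set G 1 S \<longleftrightarrow> S \<subseteq> pverts G \<and> {v \<in> pverts G. degree G v = 1} \<subseteq> S \<and>
     (\<forall>u v. thin_pair u v \<longrightarrow> u \<in> S \<or> v \<in> S)" (is "?L \<longleftrightarrow> ?R")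
proof
  assume ?L
  then show ?R
    using leaky_forcing_set_contains_leaves leaky_forcing_set_hits_thin_pair
    by (auto simp: leaky_forcing_set_def)
next
  assume R: ?R
  show ?L
    unfolding leaky_forcing_set_def
  proof (intro conjI allI impI)
    show "S \<subseteq> pverts G" using R by simp
    fix L assume "L \<subseteq> pverts G \<and> card L = 1"
    then obtain l where l: "L = {l}"
      by (auto simp: card_1_singleton_iff)
    have "\<not> stalled G {l} B" if "S \<subseteq> B" "B \<subset> pverts G" for B
      using that R stalled_imp_white_thin_pair[of B l] by blast
    then show "(leaky_force G L)\<^sup>*\<^sup>* S (pverts G)"
      using R by (simp add: forces_all_iff_no_stalled l)
  qed
qed

text \<open>
  No leaf is on the cycle, so the two requirements on a forcing set concern disjoint sets of
  vertices and the minimum splits into two summands.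
\<close>

lemma leaky_forcing_number_eqI:
  assumes T: "T \<subseteq> {a, b, c}" "\<And>u v. thin_pair u v \<Longrightarrow> u \<in> T \<or> v \<in> T"
    and min: "\<And>T'. T' \<subseteq> {a, b, c} \<Longrightarrow> (\<And>u v. thin_pair u v \<Longrightarrow> u \<in> T' \<or> v \<in> T') \<Longrightarrow> card T \<le> card T'"
  shows "leaky_forcing_number 1 G = card {v \<in> pverts G. degree G v = 1} + card T"
proof -
  let ?Q = "{v \<in> pverts G. degree G v = 1}"
  have disj: "?Q \<inter> {a, b, c} = {}"
  proof (rule equals0I)
    fix v assume "v \<in> ?Q \<inter> {a, b, c}"
    then have "degree G v = 1" "2 \<le> degree G v"
      using degree_triangle_ge_2[of v] by simp_all
    then show False by simp
  qed
  have finT: "finite T" "finite ?Q"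
    using T(1) pair_finite_verts by (auto intro: finite_subset)
  have "leaky_forcing_set G 1 (?Q \<union> T)"
    using T triangle_in_verts unfolding leaky_forcing_set_iff by blast
  moreover have "card (?Q \<union> T) = card ?Q + card T"
    using finT disj T(1) by (intro card_Un_disjoint) auto
  ultimately have mem: "card ?Q + card T \<in> card ` {S. leaky_forcing_set G 1 S}"
    by force
  have le: "card ?Q + card T \<le> card S" if S: "leaky_forcing_set G 1 S" for S
  proof -
    have S': "S \<subseteq> pverts G" "?Q \<subseteq> S" "\<And>u v. thin_pair u v \<Longrightarrow> u \<in> S \<or> v \<in> S"
      using S unfolding leaky_forcing_set_iff by auto
    have "card T \<le> card (S \<inter> {a, b, c})"
      using S'(3) by (intro min) (auto simp: thin_pair_def)
    then have "card ?Q + card T \<le> card ?Q + card (S \<inter> {a, b, c})"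
      by simp
    also have "\<dots> = card (?Q \<union> (S \<inter> {a, b, c}))"
      using finT disj by (intro card_Un_disjoint[symmetric]) auto
    also have "\<dots> \<le> card S"
      using S' pair_finite_verts by (intro card_mono) (auto intro: finite_subset)
    finally show ?thesis .
  qed
  have "finite {S. leaky_forcing_set G 1 S}"
    by (rule finite_subset[of _ "Pow (pverts G)"])
      (auto simp: leaky_forcing_set_def pair_finite_verts)
  then show ?thesis
    unfolding leaky_forcing_number_def using mem le by (intro Min_eqI) auto
qed

lemma card_filter_triangle:
  "card {v \<in> {a, b, c}. P v} = of_bool (P a) + of_bool (P b) + of_bool (P c)"
proof -
  have "card {v \<in> {a, b, c}. P v} = (\<Sum>v \<in> {a, b, c}. of_bool (P v))"
    by (simp add: Int_def flip: card_eq_sum sum.inter_filter)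
  then show ?thesis
    using distinct_abc by simp
qed

proposition leaky_forcing_number_1:
  "leaky_forcing_number 1 G = card {v \<in> pverts G. degree G v = 1} +
    (if 2 \<le> card {v \<in> {a, b, c}. 4 \<le> degree G v} \<or> (\<forall>v \<in> {a, b, c}. 3 \<le> degree G v)
     then 0
     else if card {v \<in> {a, b, c}. degree G v = 3} \<le> 1
        \<and> 2 \<le> card {v \<in> {a, b, c}. degree G v = 2}
        \<and> (\<forall>v \<in> {a, b, c}. degree G v \<le> 3)
     then 2
     else 1)"
proof -
  note thin = thin_pair_def card_filter_triangle
  have deg: "2 \<le> degree G a" "2 \<le> degree G b" "2 \<le> degree G c"
    by (simp_all add: degree_triangle_ge_2)
  let ?I = "2 \<le> card {v \<in> {a, b, c}. 4 \<le> degree G v} \<or> (\<forall>v \<in> {a, b, c}. 3 \<le> degree G v)"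
  let ?II = "card {v \<in> {a, b, c}. degree G v = 3} \<le> 1
        \<and> 2 \<le> card {v \<in> {a, b, c}. degree G v = 2} \<and> (\<forall>v \<in> {a, b, c}. degree G v \<le> 3)"
  consider (no_pair) ?I | (all_pairs) "\<not> ?I" ?II | (star) "\<not> ?I" "\<not> ?II"
    by blast
  then show ?thesis
  proof cases
    case no_pair
    then have "\<not> thin_pair u v" for u v
      using deg distinct_abc unfolding thin by (auto simp: of_bool_def split: if_splits)
    then have "leaky_forcing_number 1 G = card {v \<in> pverts G. degree G v = 1} + card ({} :: 'a set)"
      by (intro leaky_forcing_number_eqI) auto
    with no_pair show ?thesis by simp
  next
    case all_pairs
    then have pairs: "thin_pair a b" "thin_pair b c" "thin_pair c a"
      using deg distinct_abc unfolding thin by (auto simp: of_bool_def split: if_splits)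
    have "leaky_forcing_number 1 G = card {v \<in> pverts G. degree G v = 1} + card {a, b}"
    proof (rule leaky_forcing_number_eqI)
      fix T assume T: "T \<subseteq> {a, b, c}" "\<And>u v. thin_pair u v \<Longrightarrow> u \<in> T \<or> v \<in> T"
      then have "{a, b} \<subseteq> T \<or> {b, c} \<subseteq> T \<or> {c, a} \<subseteq> T"
        using pairs by blast
      moreover have "finite T"
        using T(1) by (rule finite_subset) simp
      ultimately have "\<exists>P. P \<subseteq> T \<and> card P = 2"
        using distinct_abc by (metis card_2_iff)
      then show "card {a, b} \<le> card T"
        using \<open>finite T\<close> distinct_abc by (metis card_2_iff card_mono)
    qed (auto simp: thin_pair_def)
    with all_pairs show ?thesis
      using distinct_abc by simp
  next
    case star
    \<comment> \<open>A vertex \<open>x\<close> of degree 2 lies on all thin pairs, for otherwise the two other cycle vertices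
       have degree 2 and at most 3, which is the preceding case. It lies on at least one, as
       at most one cycle vertex has degree 4 or more.\<close>
    obtain x where x: "x \<in> {a, b, c}" "degree G x < 3"
      using star(1) by (meson not_le)
    have "thin_pair x a \<or> thin_pair x b \<or> thin_pair x c"
      using x star deg distinct_abc unfolding thin by (auto simp: of_bool_def split: if_splits)
    then obtain y where y: "thin_pair x y" by blast
    have "leaky_forcing_number 1 G = card {v \<in> pverts G. degree G v = 1} + card {x}"
    proof (rule leaky_forcing_number_eqI)
      fix u v assume "thin_pair u v"
      then show "u \<in> {x} \<or> v \<in> {x}"
        using x star deg distinct_abc unfolding thin by (auto simp: of_bool_def split: if_splits)
    next
      fix T assume T: "T \<subseteq> {a, b, c}" "\<And>u v. thin_pair u v \<Longrightarrow> u \<in> T \<or> v \<in> T"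
      then have "T \<noteq> {}" "finite T"
        using y by (auto intro: finite_subset)
      then show "card {x} \<le> card T"
        by (simp add: Suc_le_eq card_gt_0_iff)
    qed (use x in auto)
    with star show ?thesis
      by simp
  qed
qed

end

theorem theorem3p6:
  fixes G :: "'a pair_pre_digraph" and Q :: "'a set" and q :: nat
  assumes "unicyclic G" and "girth G = 3"
    and "Q = {v \<in> pverts G. degree G v = 1}" and "card Q = q"
  shows "leaky_forcing_number 1 G =
    (if 2 \<le> card {v \<in> cycle_vertices G. 4 \<le> degree G v}
        \<or> (\<forall>v \<in> cycle_vertices G. 3 \<le> degree G v)
     then q
     else if card {v \<in> cycle_vertices G. degree G v = 3} \<le> 1
        \<and> 2 \<le> card {v \<in> cycle_vertices G. degree G v = 2}
        \<and> (\<forall>v \<in> cycle_vertices G. degree G v \<le> 3)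
     then q + 2
     else q + 1)"
proof -
  obtain a b c where "unicyclic_triangle G a b c" and C: "cycle_vertices G = {a, b, c}"
    using unicyclic_girth_3_triangle[OF assms(1,2)] .
  then interpret unicyclic_triangle G a b c by simp
  show ?thesis
    unfolding leaky_forcing_number_1 C assms(4)[symmetric] assms(3)
    by (simp only: if_distrib[of "(+) _"] add_0_right)
qed

end
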